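(* Let $q_0>0$, $d_0>0$, $\sigma>0$, $0\leqslant b\leqslant 1$ and $x<q_0$. Let $Q=(Q_t)_{t\geqslant 0}$ be the solution of $$\mathrm{d}Q_t = -\frac{d_0Q_t}{1+bd_0t}\,\mathrm{d}t + \sigma\,\mathrm{d}B_t,\qquad Q_0=q_0,$$ where $(B_t)$ is a standard Brownian motion, and let $T_{Q,x}=\inf\{t\geqslant 0 : Q_t=x\}$. For $t\geqslant 0$ set $$q_t = q_0(1+bd_0t)^{-1/b},\qquad \tau(t)=\frac{1}{d_0(b+2)}\left[(1+bd_0t)^{\frac{2}{b}+1}-1\right],$$ let $\tau^{-1}:[0,\infty)\to[0,\infty)$ be the inverse of the bijection $\tau$, and set $$c_1(t)=\frac{q_0}{\sigma}\left(\frac{x}{q_{\tau^{-1}(t)}}-1\right),\qquad t\geqslant 0 .$$ Let $W$ be a standard Brownian motion and $T_{W,c_1(\cdot)}=\inf\{t\geqslant 0: W_t=c_1(t)\}$. Then $T_{Q,x}$ and $\tau^{-1}(T_{W,c_1(\cdot)})$ have the same distribution.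
   Context: Conventions: $\inf\emptyset=+\infty$ and $\tau^{-1}(+\infty)=+\infty$. For $b=0$ all expressions are understood as their limits as $b\to 0$: the drift is $-d_0Q_t\,\mathrm{d}t$, $q_t=q_0e^{-d_0t}$ and $\tau(t)=\frac{1}{2d_0}(e^{2d_0t}-1)$. The SDE is in the Itô sense and has a unique strong solution with continuous paths. *)

theory Defs
  imports "HOL-Probability.Probability"
begin

locale standard_brownian_motion = prob_space M
  for M :: "'a measure" and B :: "real \<Rightarrow> 'a \<Rightarrow> real" +
  assumes measurable_BM: "\<And>t. 0 \<le> t \<Longrightarrow> B t \<in> borel_measurable M"
    and start_at_zero: "AE \<omega> in M. B 0 \<omega> = 0"
    and indep_increments: "\<And>(n :: nat) (t :: nat \<Rightarrow> real).
      0 \<le> t 0 \<Longrightarrow> (\<And>i. i < n \<Longrightarrow> t i \<le> t (Suc i)) \<Longrightarrow>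
      indep_vars (\<lambda>_. borel) (\<lambda>i \<omega>. B (t (Suc i)) \<omega> - B (t i) \<omega>) {..<n}"
    and normal_increments: "\<And>s t. 0 \<le> s \<Longrightarrow> s < t \<Longrightarrow>
      distributed M lborel (\<lambda>\<omega>. B t \<omega> - B s \<omega>) (normal_density 0 (sqrt (t - s)))"
    and continuous_paths: "\<And>\<omega>. \<omega> \<in> space M \<Longrightarrow> continuous_on {0..} (\<lambda>t. B t \<omega>)"

(* Solutions with continuous paths of dY = f(t, Y) dt + sigma dB, Y_0 = y0, for a constant
   sigma, in integral form.  The Ito integral of the constant sigma over [0, t] is
   sigma * (B_t - B_0), so no general stochastic integral is needed.  Adaptedness to a filtration
   is not required, so every adapted solution with continuous paths is covered. *)
definition additive_noise_sde_solution ::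
    "'a measure \<Rightarrow> (real \<Rightarrow> 'a \<Rightarrow> real) \<Rightarrow> (real \<Rightarrow> real \<Rightarrow> real) \<Rightarrow> real \<Rightarrow> real
      \<Rightarrow> (real \<Rightarrow> 'a \<Rightarrow> real) \<Rightarrow> bool" where
  "additive_noise_sde_solution M B f \<sigma> y0 Y \<longleftrightarrow>
     (\<forall>t\<ge>0. Y t \<in> borel_measurable M) \<and>
     (\<forall>\<omega>\<in>space M. continuous_on {0..} (\<lambda>t. Y t \<omega>)) \<and>
     (AE \<omega> in M. \<forall>t\<ge>0.
        set_integrable lborel {0..t} (\<lambda>s. f s (Y s \<omega>)) \<and>
        Y t \<omega> = y0 + (LBINT s:{0..t}. f s (Y s \<omega>)) + \<sigma> * (B t \<omega> - B 0 \<omega>))"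

(* The infimum is taken in [0, \<infinity>], so it is \<infinity> when the boundary c is never hit. *)
definition hitting_time :: "(real \<Rightarrow> 'a \<Rightarrow> real) \<Rightarrow> (real \<Rightarrow> real) \<Rightarrow> 'a \<Rightarrow> ennreal" where
  "hitting_time X c \<omega> = (INF t\<in>{t. 0 \<le> t \<and> X t \<omega> = c t}. ennreal t)"

(* The case b = 0 of the next two definitions is the limit as b \<rightarrow> 0; it has to be split off
   because division by zero yields zero. *)
definition q_path :: "real \<Rightarrow> real \<Rightarrow> real \<Rightarrow> real \<Rightarrow> real" where
  "q_path q0 d0 b t =
     (if b = 0 then q0 * exp (- d0 * t) else q0 * (1 + b * d0 * t) powr (- 1 / b))"

definition tau :: "real \<Rightarrow> real \<Rightarrow> real \<Rightarrow> real" where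
  "tau d0 b t =
     (if b = 0 then 1 / (2 * d0) * (exp (2 * d0 * t) - 1)
      else 1 / (d0 * (b + 2)) * ((1 + b * d0 * t) powr (2 / b + 1) - 1))"

definition tau_inv :: "real \<Rightarrow> real \<Rightarrow> real \<Rightarrow> real" where
  "tau_inv d0 b = the_inv_into {0..} (tau d0 b)"

definition tau_inv_ext :: "real \<Rightarrow> real \<Rightarrow> ennreal \<Rightarrow> ennreal" where
  "tau_inv_ext d0 b s = (if s = \<infinity> then \<infinity> else ennreal (tau_inv d0 b (enn2real s)))"

definition c1 :: "real \<Rightarrow> real \<Rightarrow> real \<Rightarrow> real \<Rightarrow> real \<Rightarrow> real \<Rightarrow> real" where
  "c1 q0 d0 \<sigma> b x t = q0 / \<sigma> * (x / q_path q0 d0 b (tau_inv d0 b t) - 1)"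

end

theory Submission imports Defs begin

text \<open>
  With g = q_0 / q, so that g' = d_0 g / (1 + b d_0 t) and tau' = g^2, the process
  Z = (g Q - q_0) / sigma is the Wiener integral of g against B, and Q hits x exactly when Z hits
  c_1 o tau.  So it is enough that Z and W o tau have the same law.  No stochastic integration is
  needed: the SDE shows pathwise that the sums of g(j/n) (B((j+1)/n) - B(j/n)) over j < nt tend to
  Z_t.  By independence of increments these sums have exactly the joint law of W taken at the
  Riemann sums of the integral of g^2, and those converge to tau(t).  The limit identifies the laws
  at countably many times, and for continuous paths such laws determine the law of a hitting time.
\<close>

text \<open>The function g is the integrating factor of the linear drift: it turns the equation into
  dZ = g dB, whose variance clock is tau. The obstacle is that a hitting time is not a continuous
  functional of the path, so convergence of the sums cannot be carried over to hitting times
  directly. The limit is therefore taken for laws on \<open>nat \<Rightarrow> real\<close>, where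
  convergence is coordinatewise and bounded continuous functions determine the law. Only afterwards
  is the event of a hit by time a written as a Borel set of such sequences. Sample times stay in a
  bounded interval \<open>{0..a}\<close>, so that on each grid all of the countably many coordinates
  are functions of the same finitely many increments, and independence of these gives the joint law
  at once.\<close>

section \<open>Equality of laws: limits, independent families, Brownian step sums\<close>

text \<open>Dominated convergence passes expectations of bounded continuous functions to the limit
  on both sides. These expectations fix the law because indicators of closed sets are limits of such
  functions, and the closed sets form a generating pi-system.\<close>

lemma distr_limit_eq:
  fixes X :: "nat \<Rightarrow> 'a \<Rightarrow> 'c :: metric_space" and Y :: "nat \<Rightarrow> 'b \<Rightarrow> 'c"
  assumes "prob_space M" "prob_space N"
    and X [measurable]: "\<And>n. X n \<in> borel_measurable M" "X' \<in> borel_measurable M"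
    and Y [measurable]: "\<And>n. Y n \<in> borel_measurable N" "Y' \<in> borel_measurable N"
    and eq: "\<And>n. distr M borel (X n) = distr N borel (Y n)"
    and limX: "AE \<omega> in M. (\<lambda>n. X n \<omega>) \<longlonglongrightarrow> X' \<omega>"
    and limY: "AE \<omega> in N. (\<lambda>n. Y n \<omega>) \<longlonglongrightarrow> Y' \<omega>"
  shows "distr M borel X' = distr N borel Y'"
proof -
  interpret M: prob_space M by fact
  interpret N: prob_space N by fact
  interpret DX: prob_space "distr M borel X'" by (intro M.prob_space_distr) simp
  interpret DY: prob_space "distr N borel Y'" by (intro N.prob_space_distr) simp
  have expectation_eq: "(\<integral>\<omega>. f (X' \<omega>) \<partial>M) = (\<integral>\<omega>. f (Y' \<omega>) \<partial>N)"
    if f: "continuous_on UNIV f" "\<And>x. \<bar>f x\<bar> \<le> 1" for f :: "'c \<Rightarrow> real"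
  proof -
    have [measurable]: "f \<in> borel_measurable borel"
      by (rule borel_measurable_continuous_onI) fact
    have f_lim: "(\<lambda>n. f (z n)) \<longlonglongrightarrow> f l" if "z \<longlonglongrightarrow> l" for z l
      using continuous_on_tendsto_compose[OF f(1) that] by simp
    have "(\<lambda>n. \<integral>\<omega>. f (X n \<omega>) \<partial>M) \<longlonglongrightarrow> (\<integral>\<omega>. f (X' \<omega>) \<partial>M)"
      by (rule integral_dominated_convergence[where w = "\<lambda>_. 1"])
        (use limX f(2) f_lim in auto)
    moreover have "(\<lambda>n. \<integral>\<omega>. f (Y n \<omega>) \<partial>N) \<longlonglongrightarrow> (\<integral>\<omega>. f (Y' \<omega>) \<partial>N)"
      by (rule integral_dominated_convergence[where w = "\<lambda>_. 1"])
        (use limY f(2) f_lim in auto)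
    moreover have "(\<integral>\<omega>. f (X n \<omega>) \<partial>M) = (\<integral>\<omega>. f (Y n \<omega>) \<partial>N)" for n
    proof -
      have "(\<integral>\<omega>. f (X n \<omega>) \<partial>M) = (\<integral>z. f z \<partial>distr M borel (X n))"
        by (simp add: integral_distr)
      also have "\<dots> = (\<integral>\<omega>. f (Y n \<omega>) \<partial>N)"
        by (simp add: eq integral_distr)
      finally show ?thesis .
    qed
    ultimately show ?thesis
      using LIMSEQ_unique by simp
  qed
  show ?thesis
  proof (rule measure_eqI_generator_eq[where E = "Collect closed" and \<Omega> = UNIV and A = "\<lambda>_. UNIV"])
    show "emeasure (distr M borel X') C = emeasure (distr N borel Y') C"
      if C: "C \<in> Collect closed" for C
    proof (cases "C = {}")
      case False
      have [measurable]: "C \<in> sets borel"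
        using C by auto
      \<comment> \<open>Continuous functions decreasing to the indicator of the closed set
        \<open>C\<close>. The empty set is treated apart because \<open>infdist z {}\<close> is 0 by
        convention, which would make every \<open>f n\<close> constantly 1.\<close>
      define f where "f n z = max 0 (1 - real n * infdist z C)" for n z
      have f_meas [measurable]: "f n \<in> borel_measurable borel" for n
        unfolding f_def by (intro borel_measurable_continuous_onI continuous_intros)
      have f_bound: "\<bar>f n z\<bar> \<le> 1" for n z
        using infdist_nonneg[of z C] by (auto simp: f_def max_def)
      have f_lim: "(\<lambda>n. f n z) \<longlonglongrightarrow> indicator C z" for z
      proof (cases "z \<in> C")
        case True
        then show ?thesis by (simp add: f_def)
      next
        case nC: False
        then have pos: "0 < infdist z C"
          using C False infdist_pos_not_in_closed by auto
        obtain k where k: "1 < real k * infdist z C"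
          using reals_Archimedean3[OF pos] by blast
        have "f n z = 0" if "k \<le> n" for n
        proof -
          have "real k * infdist z C \<le> real n * infdist z C"
            using that pos by (intro mult_right_mono) auto
          with k show ?thesis by (simp add: f_def)
        qed
        then have "eventually (\<lambda>n. f n z = 0) sequentially"
          using eventually_sequentially by blast
        with nC show ?thesis
          by (simp add: tendsto_eventually)
      qed
      have "(\<lambda>n. \<integral>\<omega>. f n (X' \<omega>) \<partial>M) \<longlonglongrightarrow> (\<integral>\<omega>. indicator C (X' \<omega>) \<partial>M)"
        by (rule integral_dominated_convergence[where w = "\<lambda>_. 1"])
          (use f_bound f_lim in auto)
      moreover have "(\<lambda>n. \<integral>\<omega>. f n (Y' \<omega>) \<partial>N) \<longlonglongrightarrow> (\<integral>\<omega>. indicator C (Y' \<omega>) \<partial>N)"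
        by (rule integral_dominated_convergence[where w = "\<lambda>_. 1"])
          (use f_bound f_lim in auto)
      moreover have "(\<integral>\<omega>. f n (X' \<omega>) \<partial>M) = (\<integral>\<omega>. f n (Y' \<omega>) \<partial>N)" for n
        by (rule expectation_eq[OF _ f_bound]) (unfold f_def, intro continuous_intros)
      ultimately have "(\<integral>\<omega>. indicat_real C (X' \<omega>) \<partial>M) = (\<integral>\<omega>. indicat_real C (Y' \<omega>) \<partial>N)"
        using LIMSEQ_unique by simp
      then have "(\<integral>z. indicat_real C z \<partial>distr M borel X') = (\<integral>z. indicat_real C z \<partial>distr N borel Y')"
        by (subst (1 2) integral_distr) auto
      then show ?thesis
        by (simp add: DX.emeasure_eq_measure DY.emeasure_eq_measure)
    qed simp
    have "emeasure (distr M borel X') UNIV = 1"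
      using DX.emeasure_space_1 by simp
    then show "emeasure (distr M borel X') UNIV \<noteq> \<infinity>"
      by simp
  qed (auto simp: Int_stable_def borel_eq_closed)
qed

text \<open>Independence makes the joint law the product of the marginals, which agree. For
  \<open>I = {}\<close> both laws are the point mass on the only function in the product; this case
  does occur below, when the time horizon contains no complete grid cell.\<close>

lemma distr_indep_vars_eq:
  fixes X :: "'i \<Rightarrow> 'a \<Rightarrow> 'c :: topological_space" and Y :: "'i \<Rightarrow> 'b \<Rightarrow> 'c"
  assumes "prob_space M" "prob_space N"
    and X: "prob_space.indep_vars M (\<lambda>_. borel) X I"
    and Y: "prob_space.indep_vars N (\<lambda>_. borel) Y I"
    and eq: "\<And>i. i \<in> I \<Longrightarrow> distr M borel (X i) = distr N borel (Y i)"
  shows "distr M (PiM I (\<lambda>_. borel)) (\<lambda>\<omega>. \<lambda>i\<in>I. X i \<omega>) =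
    distr N (PiM I (\<lambda>_. borel)) (\<lambda>\<omega>. \<lambda>i\<in>I. Y i \<omega>)"
proof (cases "I = {}")
  case False
  interpret M: prob_space M by fact
  interpret N: prob_space N by fact
  have "distr M (PiM I (\<lambda>_. borel)) (\<lambda>\<omega>. \<lambda>i\<in>I. X i \<omega>) = (\<Pi>\<^sub>M i\<in>I. distr M borel (X i))"
    using X M.indep_vars_iff_distr_eq_PiM'[OF False, where X = X and M' = "\<lambda>_. borel"]
    by (simp add: M.indep_vars_def)
  also have "\<dots> = (\<Pi>\<^sub>M i\<in>I. distr N borel (Y i))"
    by (intro PiM_cong refl eq)
  also have "\<dots> = distr N (PiM I (\<lambda>_. borel)) (\<lambda>\<omega>. \<lambda>i\<in>I. Y i \<omega>)"
    using Y N.indep_vars_iff_distr_eq_PiM'[OF False, where X = Y and M' = "\<lambda>_. borel"]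
    by (simp add: N.indep_vars_def)
  finally show ?thesis .
next
  case True
  interpret M: prob_space M by fact
  interpret N: prob_space N by fact
  show ?thesis
    using True M.emeasure_space_1 N.emeasure_space_1
    by (intro measure_eqI) (auto simp: emeasure_distr restrict_def PiM_empty sets_PiM_empty)
qed

text \<open>A weighted increment of \<open>B\<close> over one cell is centred normal with variance
  \<open>(v j)\<^sup>2 * (u (Suc j) - u j)\<close>, which is the length of the matching interval of
  the new clock, so an increment of \<open>W\<close> over that interval has the same law. Nonzero
  weights keep the new clock strictly increasing, so these increments have a normal density. The
  bound \<open>K\<close> reduces everything to finitely many independent increments although
  \<open>i\<close> ranges over all naturals.\<close>

lemma brownian_step_sums_distr_eq:
  assumes B: "standard_brownian_motion M B" and W: "standard_brownian_motion N W"
    and u: "0 \<le> u 0" "\<And>j. u j < u (Suc j)" and v: "\<And>j. v j \<noteq> 0"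
    and k: "\<And>i. k i \<le> (K :: nat)"
  shows "distr M borel (\<lambda>\<omega> i. \<Sum>j<k i. v j * (B (u (Suc j)) \<omega> - B (u j) \<omega>)) =
    distr N borel (\<lambda>\<omega> (i :: nat). W (\<Sum>j<k i. (v j)\<^sup>2 * (u (Suc j) - u j)) \<omega> - W 0 \<omega>)"
proof -
  interpret B: standard_brownian_motion M B by fact
  interpret W: standard_brownian_motion N W by fact
  define s where "s l = (\<Sum>j<l. (v j)\<^sup>2 * (u (Suc j) - u j))" for l
  have s0: "s 0 = 0" by (simp add: s_def)
  have s_Suc: "s (Suc j) - s j = (v j)\<^sup>2 * (u (Suc j) - u j)" for j
    by (simp add: s_def)
  have s_less: "s j < s (Suc j)" for j
    using s_Suc[of j] u(2)[of j] v[of j] by (smt (verit) mult_pos_pos zero_less_power2)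
  have s_nonneg: "0 \<le> s j" for j
    unfolding s_def using u(2) by (intro sum_nonneg mult_nonneg_nonneg) (auto simp: less_imp_le)
  have u_nonneg: "0 \<le> u j" for j
    using u(1) u(2) by (induction j) (auto intro: less_imp_le order.trans)
  define X where "X j \<omega> = v j * (B (u (Suc j)) \<omega> - B (u j) \<omega>)" for j \<omega>
  define Y where "Y j \<omega> = W (s (Suc j)) \<omega> - W (s j) \<omega>" for j \<omega>
  \<comment> \<open>One map sends the increments to all required partial sums, so that the equality
    of joint laws is pushed forward only once.\<close>
  define S :: "(nat \<Rightarrow> real) \<Rightarrow> nat \<Rightarrow> real" where "S z i = (\<Sum>j<k i. z j)" for z i
  note [measurable] = B.measurable_BM[OF u_nonneg] W.measurable_BM[OF s_nonneg] W.measurable_BM[of 0]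
  have X_meas [measurable]: "X j \<in> borel_measurable M" for j unfolding X_def by measurable
  have Y_meas [measurable]: "Y j \<in> borel_measurable N" for j unfolding Y_def by measurable
  have indep_X: "B.indep_vars (\<lambda>_. borel) X {..<K}"
  proof -
    have "B.indep_vars (\<lambda>_. borel) (\<lambda>j \<omega>. B (u (Suc j)) \<omega> - B (u j) \<omega>) {..<K}"
      by (rule B.indep_increments) (use u in \<open>auto intro: less_imp_le\<close>)
    then have "B.indep_vars (\<lambda>_. borel)
        (\<lambda>j \<omega>. (\<lambda>z. v j * z) (B (u (Suc j)) \<omega> - B (u j) \<omega>)) {..<K}"
      by (rule B.indep_vars_compose2) simp
    then show ?thesis unfolding X_def .
  qed
  have indep_Y: "W.indep_vars (\<lambda>_. borel) Y {..<K}"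
    unfolding Y_def by (rule W.indep_increments) (use s0 s_less in \<open>auto intro: less_imp_le\<close>)
  have "distr M borel (X j) = distr N borel (Y j)" for j
  proof -
    have "distributed M lborel (\<lambda>\<omega>. 0 + v j * (B (u (Suc j)) \<omega> - B (u j) \<omega>))
        (normal_density (0 + v j * 0) (\<bar>v j\<bar> * sqrt (u (Suc j) - u j)))"
      by (intro B.normal_density_affine B.normal_increments) (use u v u_nonneg in auto)
    moreover have "\<bar>v j\<bar> * sqrt (u (Suc j) - u j) = sqrt (s (Suc j) - s j)"
      by (simp add: s_Suc real_sqrt_mult)
    ultimately have "distributed M lborel (X j) (normal_density 0 (sqrt (s (Suc j) - s j)))"
      by (simp add: X_def[abs_def])
    moreover have "distributed N lborel (Y j) (normal_density 0 (sqrt (s (Suc j) - s j)))"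
      unfolding Y_def[abs_def] by (intro W.normal_increments s_nonneg s_less)
    ultimately have "distr M lborel (X j) = distr N lborel (Y j)"
      by (simp add: distributed_distr_eq_density)
    then show ?thesis
      by (simp cong: distr_cong)
  qed
  then have joint: "distr M (PiM {..<K} (\<lambda>_. borel)) (\<lambda>\<omega>. \<lambda>i\<in>{..<K}. X i \<omega>) =
      distr N (PiM {..<K} (\<lambda>_. borel)) (\<lambda>\<omega>. \<lambda>i\<in>{..<K}. Y i \<omega>)"
    by (intro distr_indep_vars_eq B.prob_space_axioms W.prob_space_axioms indep_X indep_Y)
  have S_meas [measurable]: "S \<in> PiM {..<K} (\<lambda>_. borel) \<rightarrow>\<^sub>M borel"
    unfolding S_def[abs_def]
    by (intro measurable_coordinatewise_then_product borel_measurable_sum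
      measurable_component_singleton) (use k in \<open>auto intro: less_le_trans\<close>)
  \<comment> \<open>Restriction puts \<open>undefined\<close> at the coordinates from
    \<open>K\<close> on; \<open>k i \<le> K\<close> keeps these out of every sum.\<close>
  have S_restrict: "S (\<lambda>i\<in>{..<K}. z i) = S z" for z
  proof
    fix i
    show "S (\<lambda>i\<in>{..<K}. z i) i = S z i"
      unfolding S_def using k[of i] by (intro sum.cong) auto
  qed
  have "distr M borel (\<lambda>\<omega>. S (\<lambda>i\<in>{..<K}. X i \<omega>)) = distr N borel (\<lambda>\<omega>. S (\<lambda>i\<in>{..<K}. Y i \<omega>))"
    using arg_cong[OF joint, of "\<lambda>D. distr D borel S"]
    by (subst (asm) (1 2) distr_distr) (auto simp: comp_def)
  moreover have "S (\<lambda>j. Y j \<omega>) = (\<lambda>i. W (s (k i)) \<omega> - W 0 \<omega>)" for \<omega>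
    using sum_lessThan_telescope[of "\<lambda>j. W (s j) \<omega>"] by (simp add: S_def Y_def fun_eq_iff s0)
  ultimately show ?thesis
    unfolding S_restrict by (simp add: S_def[abs_def] X_def s_def)
qed

section \<open>Pathwise limits of sums over a uniform grid\<close>

text \<open>At most \<open>n * t\<close> cells of width \<open>1 / n\<close>, each with error at
  most \<open>e / n\<close>, contribute at most \<open>e * t\<close> in total. The increments of
  \<open>\<Phi>\<close> telescope up to the last grid point, which lies within \<open>1 / n\<close>
  of \<open>t\<close>, so continuity of \<open>\<Phi>\<close> closes the gap.\<close>

lemma telescoping_sum_limit:
  fixes S :: "real \<Rightarrow> real \<Rightarrow> real" and \<Phi> :: "real \<Rightarrow> real"
  assumes cont: "continuous_on {0..} \<Phi>" and t: "0 \<le> t"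
    and close: "\<And>e. 0 < e \<Longrightarrow> \<exists>d>0. \<forall>u v. 0 \<le> u \<and> u < v \<and> v \<le> t \<and> v - u < d \<longrightarrow>
      \<bar>S u v - (\<Phi> v - \<Phi> u)\<bar> \<le> e * (v - u)"
  shows "(\<lambda>n. \<Sum>j<nat \<lfloor>real n * t\<rfloor>. S (real j / real n) (real (Suc j) / real n)) \<longlonglongrightarrow> \<Phi> t - \<Phi> 0"
proof -
  define k where "k n = nat \<lfloor>real n * t\<rfloor>" for n
  have k_le: "real (k n) \<le> real n * t" and k_gt: "real n * t < real (k n) + 1" for n
    using t by (auto simp: k_def)
  have grid_le: "real (k n) / real n \<le> t" for n
    using k_le[of n] t by (cases "n = 0") (auto simp: field_simps)
  have "(\<lambda>n. real (k n) / real n) \<longlonglongrightarrow> t"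
  proof (rule tendsto_sandwich)
    show "\<forall>\<^sub>F n in sequentially. t - 1 / real n \<le> real (k n) / real n"
      using eventually_gt_at_top[of 0]
    proof eventually_elim
      case (elim n)
      then have "t \<le> (real (k n) + 1) / real n"
        using k_gt[of n] by (simp add: pos_le_divide_eq mult.commute)
      then show ?case by (simp add: add_divide_distrib)
    qed
    have "(\<lambda>n. t - 1 / real n) \<longlonglongrightarrow> t - 0"
      by (intro tendsto_intros lim_1_over_n)
    then show "(\<lambda>n. t - 1 / real n) \<longlonglongrightarrow> t" by simp
  qed (use grid_le in auto)
  then have "(\<lambda>n. \<Phi> (real (k n) / real n)) \<longlonglongrightarrow> \<Phi> t"
    by (rule continuous_on_tendsto_compose[OF cont]) (use t in auto)
  then have main: "(\<lambda>n. \<Phi> (real (k n) / real n) - \<Phi> 0) \<longlonglongrightarrow> \<Phi> t - \<Phi> 0"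
    by (intro tendsto_intros)
  have error: "(\<lambda>n. (\<Sum>j<k n. S (real j / real n) (real (Suc j) / real n)) -
      (\<Phi> (real (k n) / real n) - \<Phi> 0)) \<longlonglongrightarrow> 0"
  proof (rule LIMSEQ_I)
    fix r :: real assume "0 < r"
    \<comment> \<open>The denominator uses \<open>t + 1\<close> so that it stays positive for
      \<open>t = 0\<close> while \<open>e * t < r\<close> still holds.\<close>
    define e where "e = r / (2 * (t + 1))"
    have e: "0 < e" "e * t < r"
      using \<open>0 < r\<close> t mult_nonneg_nonneg[of r t]
      by (auto simp: e_def field_simps intro: add_nonneg_pos)
    obtain d where d: "0 < d"
      "\<And>u v. 0 \<le> u \<Longrightarrow> u < v \<Longrightarrow> v \<le> t \<Longrightarrow> v - u < d \<Longrightarrow> \<bar>S u v - (\<Phi> v - \<Phi> u)\<bar> \<le> e * (v - u)"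
      using close[OF e(1)] by blast
    obtain n0 where n0: "1 / d < real n0" using reals_Archimedean2 by blast
    have "norm ((\<Sum>j<k n. S (real j / real n) (real (Suc j) / real n)) -
        (\<Phi> (real (k n) / real n) - \<Phi> 0) - 0) < r" if "n0 \<le> n" for n
    proof -
      have n: "1 / d < real n" using n0 that by linarith
      have n_pos: "0 < real n" by (rule less_trans[OF _ n]) (use d in simp)
      have mesh: "1 / real n < d" using n d n_pos by (simp add: field_simps)
      have step: "real (Suc j) / real n - real j / real n = 1 / real n" for j
        by (simp add: diff_divide_distrib[symmetric])
      have tele: "\<Phi> (real (k n) / real n) - \<Phi> 0 =
          (\<Sum>j<k n. \<Phi> (real (Suc j) / real n) - \<Phi> (real j / real n))"
        using sum_lessThan_telescope[of "\<lambda>j. \<Phi> (real j / real n)" "k n"] by simp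
      have "\<bar>(\<Sum>j<k n. S (real j / real n) (real (Suc j) / real n)) - (\<Phi> (real (k n) / real n) - \<Phi> 0)\<bar>
          = \<bar>\<Sum>j<k n. S (real j / real n) (real (Suc j) / real n) -
              (\<Phi> (real (Suc j) / real n) - \<Phi> (real j / real n))\<bar>"
        unfolding tele sum_subtractf ..
      also have "\<dots> \<le> (\<Sum>j<k n. e * (1 / real n))"
      proof (rule order.trans[OF sum_abs sum_mono])
        fix j assume "j \<in> {..<k n}"
        then have "real (Suc j) \<le> real n * t" using k_le[of n] by auto
        then have "real (Suc j) / real n \<le> t"
          using n_pos by (simp add: pos_divide_le_eq mult.commute)
        then show "\<bar>S (real j / real n) (real (Suc j) / real n) -
            (\<Phi> (real (Suc j) / real n) - \<Phi> (real j / real n))\<bar> \<le> e * (1 / real n)"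
          using d(2)[of "real j / real n" "real (Suc j) / real n"] n_pos mesh step[of j]
          by (simp add: divide_strict_right_mono)
      qed
      also have "\<dots> = e * (real (k n) / real n)" by simp
      also have "\<dots> \<le> e * t" using grid_le e(1) by (intro mult_left_mono) auto
      finally show ?thesis using e(2) by simp
    qed
    then show "\<exists>no. \<forall>n\<ge>no. norm ((\<Sum>j<k n. S (real j / real n) (real (Suc j) / real n)) -
        (\<Phi> (real (k n) / real n) - \<Phi> 0) - 0) < r"
      by blast
  qed
  show ?thesis
    using tendsto_add[OF error main] by (simp add: k_def)
qed

text \<open>Serves to bound the error on one cell, where functions are evaluated at different points
  of the same short interval and cancel if all the points coincide. The four slots hold the two
  endpoints and up to two intermediate points from mean value theorems; uniform continuity on the
  compact cube makes the bound independent of the cell.\<close>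

lemma continuous_close_on_diagonal:
  fixes H :: "real \<times> real \<times> real \<times> real \<Rightarrow> real"
  assumes cont: "continuous_on ({0..t} \<times> {0..t} \<times> {0..t} \<times> {0..t}) H"
    and diag: "\<And>u. u \<in> {0..t} \<Longrightarrow> H (u, u, u, u) = 0" and e: "0 < e"
  obtains d where "0 < d"
    "\<And>u w z v. 0 \<le> u \<Longrightarrow> u \<le> w \<Longrightarrow> w \<le> v \<Longrightarrow> u \<le> z \<Longrightarrow> z \<le> v \<Longrightarrow> v \<le> t \<Longrightarrow> v - u < d \<Longrightarrow>
      \<bar>H (u, w, z, v)\<bar> \<le> e"
proof -
  have "uniformly_continuous_on ({0..t} \<times> {0..t} \<times> {0..t} \<times> {0..t}) H"
    by (intro compact_uniformly_continuous cont compact_Times compact_Icc)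
  then obtain d where d: "0 < d"
    "\<And>p q. p \<in> {0..t} \<times> {0..t} \<times> {0..t} \<times> {0..t} \<Longrightarrow> q \<in> {0..t} \<times> {0..t} \<times> {0..t} \<times> {0..t} \<Longrightarrow>
      dist q p < d \<Longrightarrow> dist (H q) (H p) < e"
    unfolding uniformly_continuous_on_def using e by metis
  show thesis
  proof
    \<comment> \<open>The distance to the diagonal point is at most the sum of three coordinate
      differences, each at most \<open>v - u\<close>.\<close>
    show "0 < d / 3" using d by simp
    fix u w z v assume *: "0 \<le> u" "u \<le> w" "w \<le> v" "u \<le> z" "z \<le> v" "v \<le> t" "v - u < d / 3"
    have "dist (u, w, z, v) (u, u, u, u) \<le> dist w u + (dist z u + dist v u)"
      unfolding dist_Pair_Pair
      using sqrt_sum_squares_le_sum[of "dist w u" "sqrt ((dist z u)\<^sup>2 + (dist v u)\<^sup>2)"]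
        sqrt_sum_squares_le_sum[of "dist z u" "dist v u"] by simp
    also have "\<dots> < d" using * by (simp add: dist_real_def)
    finally have "dist (H (u, w, z, v)) (H (u, u, u, u)) < e"
      using * by (intro d(2)) auto
    then show "\<bar>H (u, w, z, v)\<bar> \<le> e"
      using diag[of u] * by (simp add: dist_real_def)
  qed
qed

text \<open>Stated for derivatives within \<open>T\<close> because the functions of interest are
  controlled only on \<open>{0..}\<close> or \<open>{0..t}\<close>, where the derivative at an
  endpoint is one-sided.\<close>

lemma mean_value_within:
  fixes F f :: "real \<Rightarrow> real"
  assumes "u < v" and "\<And>s. u \<le> s \<Longrightarrow> s \<le> v \<Longrightarrow> (F has_real_derivative f s) (at s within T)"
    and "{u..v} \<subseteq> T"
  obtains w where "u < w" "w < v" "F v - F u = (v - u) * f w"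
proof -
  have "\<exists>w\<in>{u<..<v}. F v - F u = (\<lambda>h. f w * h) (v - u)"
    using assms(2)[THEN DERIV_subset, OF _ _ assms(3)]
    by (intro mvt_simple assms(1)) (auto simp: has_field_derivative_def)
  then show thesis using that by (auto simp: mult.commute)
qed

text \<open>By the mean value theorem the error on a cell is \<open>(f u - f w) * (v - u)\<close>
  with \<open>w\<close> inside the cell. It will be applied to the square of the integrating factor,
  whose primitive is \<open>tau\<close>.\<close>

lemma riemann_sum_limit:
  fixes f F :: "real \<Rightarrow> real"
  assumes F: "\<And>s. 0 \<le> s \<Longrightarrow> (F has_real_derivative f s) (at s within {0..})"
    and f: "continuous_on {0..} f" and t: "0 \<le> t"
  shows "(\<lambda>n. \<Sum>j<nat \<lfloor>real n * t\<rfloor>. f (real j / real n) * (real (Suc j) / real n - real j / real n))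
    \<longlonglongrightarrow> F t - F 0"
proof (rule telescoping_sum_limit[OF _ t])
  show "continuous_on {0..} F"
    using F by (auto intro!: DERIV_continuous_on)
  fix e :: real assume e: "0 < e"
  let ?H = "\<lambda>(u, w, z, v). f u - f w"
  have f': "continuous_on {0..t} f" using f by (rule continuous_on_subset) auto
  obtain d where d: "0 < d"
    "\<And>u w z v. 0 \<le> u \<Longrightarrow> u \<le> w \<Longrightarrow> w \<le> v \<Longrightarrow> u \<le> z \<Longrightarrow> z \<le> v \<Longrightarrow> v \<le> t \<Longrightarrow> v - u < d \<Longrightarrow>
      \<bar>?H (u, w, z, v)\<bar> \<le> e"
  proof (rule continuous_close_on_diagonal[OF _ _ e])
    show "continuous_on ({0..t} \<times> {0..t} \<times> {0..t} \<times> {0..t}) ?H"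
      unfolding split_beta
      by (intro continuous_intros continuous_on_compose2[OF f']) auto
  qed (auto)
  show "\<exists>d>0. \<forall>u v. 0 \<le> u \<and> u < v \<and> v \<le> t \<and> v - u < d \<longrightarrow>
      \<bar>f u * (v - u) - (F v - F u)\<bar> \<le> e * (v - u)"
  proof (intro exI conjI allI impI)
    fix u v assume *: "0 \<le> u \<and> u < v \<and> v \<le> t \<and> v - u < d"
    obtain w where w: "u < w" "w < v" "F v - F u = (v - u) * f w"
      by (rule mean_value_within[of u v F f "{0..}"]) (use F * in auto)
    have "f u * (v - u) - (F v - F u) = (f u - f w) * (v - u)"
      unfolding w(3) by (simp add: algebra_simps)
    then have "\<bar>f u * (v - u) - (F v - F u)\<bar> = \<bar>f u - f w\<bar> * (v - u)"
      using * by (simp add: abs_mult)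
    also have "\<dots> \<le> e * (v - u)"
      using d(2)[of u w v w] w * by (intro mult_right_mono) auto
    finally show "\<bar>f u * (v - u) - (F v - F u)\<bar> \<le> e * (v - u)" .
  qed (use d in auto)
qed

text \<open>
  Neither y nor w is differentiable, but the increment of g y minus the sum term equals
  (g v - g u) y v - g u (I v - I u) with I the integral of a y; the mean value theorem for the
  smooth functions g and I makes this o(v - u).
\<close>

lemma variation_of_constants_limit:
  fixes a g y w :: "real \<Rightarrow> real"
  assumes g: "\<And>s. 0 \<le> s \<Longrightarrow> (g has_real_derivative a s * g s) (at s within {0..})"
    and a: "continuous_on {0..} a" and y: "continuous_on {0..} y"
    and eq: "\<And>t. 0 \<le> t \<Longrightarrow> set_integrable lborel {0..t} (\<lambda>s. - (a s * y s)) \<and>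
      y t = y0 + (LBINT s:{0..t}. - (a s * y s)) + \<sigma> * (w t - w 0)"
    and t: "0 \<le> t"
  shows "(\<lambda>n. \<Sum>j<nat \<lfloor>real n * t\<rfloor>. \<sigma> * (g (real j / real n) * (w (real (Suc j) / real n) - w (real j / real n))))
    \<longlonglongrightarrow> g t * y t - g 0 * y 0"
proof (rule telescoping_sum_limit[where \<Phi> = "\<lambda>s. g s * y s", OF _ t])
  have g_cont: "continuous_on {0..} g"
    using g by (auto intro!: DERIV_continuous_on)
  then show "continuous_on {0..} (\<lambda>s. g s * y s)" by (intro continuous_intros y)
  define I where "I v = integral {0..v} (\<lambda>s. a s * y s)" for v
  have I: "(I has_real_derivative a s * y s) (at s within {0..t})" if "s \<in> {0..t}" for s
    unfolding I_def by (rule integral_has_real_derivative[OF _ that])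
      (intro continuous_intros continuous_on_subset[OF a] continuous_on_subset[OF y]; auto)
  \<comment> \<open>Subtracting the integral equation at \<open>u\<close> from the one at
    \<open>v\<close> replaces the rough increment of \<open>w\<close> by quantities that the
    estimate can handle.\<close>
  have increment: "\<sigma> * (w v - w u) = y v - y u + (I v - I u)" if "0 \<le> u" "0 \<le> v" for u v
  proof -
    have "y s = y0 - I s + \<sigma> * (w s - w 0)" if "0 \<le> s" for s
      using eq[OF that] set_borel_integral_eq_integral(2)[of "{0..s}" "\<lambda>s. - (a s * y s)"]
      by (simp add: I_def)
    from this[of u] this[of v] that show ?thesis by (simp add: algebra_simps)
  qed
  fix e :: real assume e: "0 < e"
  \<comment> \<open>The error per unit of cell length. It vanishes on the diagonal exactly because
    \<open>g\<close> has logarithmic derivative \<open>a\<close>: the growth of \<open>g\<close>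
    cancels the drift of \<open>y\<close>.\<close>
  let ?H = "\<lambda>(u, p, q, v). g u * (a p * y p) - (a q * g q) * y v"
  have cont: "continuous_on {0..t} g" "continuous_on {0..t} a" "continuous_on {0..t} y"
    by (rule continuous_on_subset[OF g_cont] continuous_on_subset[OF a] continuous_on_subset[OF y]; auto)+
  obtain d where d: "0 < d"
    "\<And>u p q v. 0 \<le> u \<Longrightarrow> u \<le> p \<Longrightarrow> p \<le> v \<Longrightarrow> u \<le> q \<Longrightarrow> q \<le> v \<Longrightarrow> v \<le> t \<Longrightarrow> v - u < d \<Longrightarrow>
      \<bar>?H (u, p, q, v)\<bar> \<le> e"
  proof (rule continuous_close_on_diagonal[OF _ _ e])
    show "continuous_on ({0..t} \<times> {0..t} \<times> {0..t} \<times> {0..t}) ?H"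
      unfolding split_beta
      by (intro continuous_intros continuous_on_compose2[OF cont(1)]
        continuous_on_compose2[OF cont(2)] continuous_on_compose2[OF cont(3)]) auto
  qed auto
  show "\<exists>d>0. \<forall>u v. 0 \<le> u \<and> u < v \<and> v \<le> t \<and> v - u < d \<longrightarrow>
      \<bar>\<sigma> * (g u * (w v - w u)) - (g v * y v - g u * y u)\<bar> \<le> e * (v - u)"
  proof (intro exI conjI allI impI)
    fix u v assume *: "0 \<le> u \<and> u < v \<and> v \<le> t \<and> v - u < d"
    obtain q where q: "u < q" "q < v" "g v - g u = (v - u) * (a q * g q)"
      by (rule mean_value_within[of u v g "\<lambda>s. a s * g s" "{0..}"]) (use g * in auto)
    obtain p where p: "u < p" "p < v" "I v - I u = (v - u) * (a p * y p)"
      by (rule mean_value_within[of u v I "\<lambda>s. a s * y s" "{0..t}"]) (use I * in auto)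
    have "\<sigma> * (g u * (w v - w u)) - (g v * y v - g u * y u) =
        g u * (\<sigma> * (w v - w u)) - (g v * y v - g u * y u)" by simp
    also have "\<dots> = g u * (y v - y u + (I v - I u)) - (g v * y v - g u * y u)"
      using increment[of u v] * by simp
    also have "\<dots> = g u * (I v - I u) - (g v - g u) * y v"
      by (simp add: algebra_simps)
    also have "\<dots> = (v - u) * ?H (u, p, q, v)"
      unfolding p(3) q(3) by (simp add: algebra_simps)
    finally have "\<bar>\<sigma> * (g u * (w v - w u)) - (g v * y v - g u * y u)\<bar> = \<bar>?H (u, p, q, v)\<bar> * (v - u)"
      using * by (simp add: abs_mult)
    also have "\<dots> \<le> e * (v - u)"
      using d(2)[of u p v q] p q * by (intro mult_right_mono) auto
    finally show "\<bar>\<sigma> * (g u * (w v - w u)) - (g v * y v - g u * y u)\<bar> \<le> e * (v - u)" .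
  qed (use d in auto)
qed

section \<open>Hitting times of continuous paths and their laws\<close>

text \<open>Continuity makes the set of contact times closed, so the infimum is attained whenever
  this set is nonempty.\<close>

lemma hitting_time_cases:
  assumes "continuous_on {0..} (\<lambda>t. X t \<omega>)" "continuous_on {0..} c"
  obtains (hit) s where "0 \<le> s" "X s \<omega> = c s" "\<And>t. 0 \<le> t \<Longrightarrow> X t \<omega> = c t \<Longrightarrow> s \<le> t"
      "hitting_time X c \<omega> = ennreal s"
  | (never) "\<And>t. 0 \<le> t \<Longrightarrow> X t \<omega> \<noteq> c t" "hitting_time X c \<omega> = \<infinity>"
proof (cases "\<exists>t\<ge>0. X t \<omega> = c t")
  case True
  define A where "A = {t \<in> {0..}. X t \<omega> = c t}"
  have A: "A \<noteq> {}" "bdd_below A" using True by (auto simp: A_def bdd_below_def)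
  have "closed ({0..} \<inter> (\<lambda>t. X t \<omega> - c t) -` {0})"
    by (intro continuous_closed_preimage continuous_intros assms)
  also have "{0..} \<inter> (\<lambda>t. X t \<omega> - c t) -` {0} = A"
    by (auto simp: A_def)
  finally have "Inf A \<in> A" by (intro closed_contains_Inf A)
  moreover have "Inf A \<le> t" if "t \<in> A" for t by (intro cInf_lower that A)
  moreover from calculation have "hitting_time X c \<omega> = ennreal (Inf A)"
    unfolding hitting_time_def
    by (intro antisym INF_lower INF_greatest ennreal_leI) (auto simp: A_def)
  ultimately show thesis
    using hit[of "Inf A"] by (auto simp: A_def)
next
  case False
  then have "{t. 0 \<le> t \<and> X t \<omega> = c t} = {}" by auto
  with False show thesis
    by (intro never) (auto simp: hitting_time_def)
qed

lemma hitting_time_le_iff: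
  assumes "continuous_on {0..} (\<lambda>t. X t \<omega>)" "continuous_on {0..} c" "0 \<le> a"
  shows "hitting_time X c \<omega> \<le> ennreal a \<longleftrightarrow> (\<exists>t\<in>{0..a}. X t \<omega> = c t)"
  using assms(1,2)
proof (cases rule: hitting_time_cases)
  case (hit s)
  then show ?thesis using assms(3) by (auto simp: ennreal_le_iff) (meson order.trans)
next
  case never
  then show ?thesis by (auto simp: top_unique)
qed

text \<open>On a compact set \<open>\<bar>f\<bar>\<close> attains its minimum, and by continuity its
  infimum over a dense sequence is the same number. This turns an uncountable existential into a
  countable condition.\<close>

lemma zero_on_compact_iff_dense:
  fixes f :: "'c :: metric_space \<Rightarrow> real"
  assumes f: "continuous_on K f" and K: "compact K" and r: "range r \<subseteq> K" "K \<subseteq> closure (range r)"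
  shows "(\<exists>t\<in>K. f t = 0) \<longleftrightarrow> (\<forall>n. \<exists>i :: nat. \<bar>f (r i)\<bar> < 1 / real (Suc n))"
proof
  assume "\<exists>t\<in>K. f t = 0"
  then obtain t where t: "t \<in> K" "f t = 0" by auto
  show "\<forall>n. \<exists>i. \<bar>f (r i)\<bar> < 1 / real (Suc n)"
  proof
    fix n
    obtain z where z: "\<And>m. z m \<in> range r" "z \<longlonglongrightarrow> t"
      using t(1) r(2) closure_sequential by blast
    have "(\<lambda>m. f (z m)) \<longlonglongrightarrow> 0"
      using continuous_on_tendsto_compose[OF f z(2) t(1)] z(1) r(1) t(2)
      by (auto simp: subset_iff)
    then have "eventually (\<lambda>m. \<bar>f (z m)\<bar> < 1 / real (Suc n)) sequentially"
      using tendstoD[of "\<lambda>m. f (z m)" 0 sequentially "1 / real (Suc n)"] by simp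
    then obtain m where "\<bar>f (z m)\<bar> < 1 / real (Suc n)"
      by (auto simp: eventually_sequentially)
    then show "\<exists>i. \<bar>f (r i)\<bar> < 1 / real (Suc n)" using z(1)[of m] by auto
  qed
next
  assume small: "\<forall>n. \<exists>i. \<bar>f (r i)\<bar> < 1 / real (Suc n)"
  have "K \<noteq> {}" using r(1) by auto
  then obtain t where t: "t \<in> K" "\<And>s. s \<in> K \<Longrightarrow> \<bar>f t\<bar> \<le> \<bar>f s\<bar>"
    using continuous_attains_inf[OF K, of "\<lambda>s. \<bar>f s\<bar>"] f by (auto intro: continuous_intros)
  have "f t = 0"
  proof (rule ccontr)
    assume "f t \<noteq> 0"
    then obtain n where "inverse (real (Suc n)) < \<bar>f t\<bar>"
      using reals_Archimedean[of "\<bar>f t\<bar>"] by auto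
    moreover obtain i where "\<bar>f (r i)\<bar> < 1 / real (Suc n)" using small by blast
    moreover have "\<bar>f t\<bar> \<le> \<bar>f (r i)\<bar>" using t(2) r(1) by auto
    ultimately show False by (simp add: inverse_eq_divide)
  qed
  with t(1) show "\<exists>t\<in>K. f t = 0" by blast
qed

text \<open>The point is the order of quantifiers: \<open>r\<close> and \<open>E\<close> depend on
  the boundary and the horizon but not on the path, so the same Borel set serves two processes on
  different probability spaces.\<close>

lemma path_hits_event:
  fixes c :: "real \<Rightarrow> real"
  assumes c: "continuous_on {0..} c" and a: "0 \<le> a"
  obtains r :: "nat \<Rightarrow> real" and E :: "(nat \<Rightarrow> real) set"
  where "range r \<subseteq> {0..a}" "E \<in> sets borel"
    "\<And>f. continuous_on {0..} f \<Longrightarrow> (\<exists>t\<in>{0..a}. f t = c t) \<longleftrightarrow> (\<lambda>i. f (r i)) \<in> E"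
proof -
  obtain T where T: "countable T" "T \<subseteq> {0..a}" "{0..a} \<subseteq> closure T"
    using separable by blast
  \<comment> \<open>Nonemptiness is what makes \<open>from_nat_into T\<close> enumerate exactly
    \<open>T\<close>.\<close>
  have "T \<noteq> {}" using T(3) a by auto
  define r where "r = from_nat_into T"
  have range_r: "range r = T" unfolding r_def by (rule range_from_nat_into) fact+
  define E :: "(nat \<Rightarrow> real) set" where
    "E = {z. \<forall>n. \<exists>i. \<bar>z i - c (r i)\<bar> < 1 / real (Suc n)}"
  have "E \<in> sets borel" unfolding E_def by measurable
  moreover have "(\<exists>t\<in>{0..a}. f t = c t) \<longleftrightarrow> (\<lambda>i. f (r i)) \<in> E"
    if f: "continuous_on {0..} f" for f
  proof -
    have "continuous_on {0..a} (\<lambda>t. f t - c t)"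
      using continuous_on_diff[OF f c] by (rule continuous_on_subset) auto
    from zero_on_compact_iff_dense[OF this compact_Icc, of r] show ?thesis
      using T range_r by (simp add: E_def)
  qed
  ultimately show thesis using that range_r T(2) by blast
qed

lemma hitting_time_measurable:
  assumes X: "\<And>t. 0 \<le> t \<Longrightarrow> X t \<in> borel_measurable M"
    and X_cont: "\<And>\<omega>. \<omega> \<in> space M \<Longrightarrow> continuous_on {0..} (\<lambda>t. X t \<omega>)"
    and c: "continuous_on {0..} c"
  shows "hitting_time X c \<in> borel_measurable M"
proof (rule borel_measurableI_le)
  fix y :: ennreal
  show "{\<omega> \<in> space M. hitting_time X c \<omega> \<le> y} \<in> sets M"
  proof (cases y)
    case (real a)
    obtain r :: "nat \<Rightarrow> real" and E where r: "range r \<subseteq> {0..a}" and E: "E \<in> sets borel"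
      and iff: "\<And>f. continuous_on {0..} f \<Longrightarrow> (\<exists>t\<in>{0..a}. f t = c t) \<longleftrightarrow> (\<lambda>i. f (r i)) \<in> E"
      by (rule path_hits_event[OF c real(1)]) (rule that)
    have "{\<omega> \<in> space M. hitting_time X c \<omega> \<le> y} = (\<lambda>\<omega> i. X (r i) \<omega>) -` E \<inter> space M"
      using hitting_time_le_iff[of X _ c a, OF X_cont c real(1)] iff[OF X_cont] real(2) by auto
    moreover have "(\<lambda>\<omega> i. X (r i) \<omega>) \<in> borel_measurable M"
      using r by (intro measurable_coordinatewise_then_product X) (auto simp: subset_iff)
    ultimately show ?thesis
      using measurable_sets[OF _ E] by simp
  qed simp
qed

text \<open>The closed lower rays are a generating pi-system; the ray up to infinity is the whole
  space, where both measures have mass 1.\<close>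

lemma borel_ennreal_eqI:
  fixes \<mu> \<nu> :: "ennreal measure"
  assumes "prob_space \<mu>" "prob_space \<nu>" and [simp]: "sets \<mu> = sets borel" "sets \<nu> = sets borel"
    and eq: "\<And>a. 0 \<le> a \<Longrightarrow> emeasure \<mu> {..ennreal a} = emeasure \<nu> {..ennreal a}"
  shows "\<mu> = \<nu>"
proof -
  interpret \<mu>: prob_space \<mu> by fact
  interpret \<nu>: prob_space \<nu> by fact
  have space: "space \<mu> = UNIV" "space \<nu> = UNIV"
    using sets_eq_imp_space_eq[of \<mu> borel] sets_eq_imp_space_eq[of \<nu> borel] by auto
  have UNIV_top: "{..top :: ennreal} = UNIV" by auto
  have top: "emeasure \<mu> {..top} = 1" "emeasure \<nu> {..top} = 1"
    using \<mu>.emeasure_space_1 \<nu>.emeasure_space_1 by (simp_all add: UNIV_top space)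
  have generated: "sets (borel :: ennreal measure) = sigma_sets UNIV (range atMost)"
  proof -
    have "sets (borel :: ennreal measure) = sigma_sets UNIV (range greaterThan)"
      unfolding borel_Ioi by simp
    also have "\<dots> = sigma_sets UNIV (range atMost)"
    proof (rule sigma_sets_eqI)
      fix A :: "ennreal set" assume "A \<in> range greaterThan"
      then obtain y where "A = {y<..}" by auto
      then have "A = UNIV - {..y}" by auto
      then show "A \<in> sigma_sets UNIV (range atMost)" by (auto intro: sigma_sets.intros)
    next
      fix A :: "ennreal set" assume "A \<in> range atMost"
      then obtain y where "A = {..y}" by auto
      then have "A = UNIV - {y<..}" by auto
      then show "A \<in> sigma_sets UNIV (range greaterThan)" by (auto intro: sigma_sets.intros)
    qed
    finally show ?thesis .
  qed
  show ?thesis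
  proof (rule measure_eqI_generator_eq[where E = "range atMost" and \<Omega> = UNIV and A = "\<lambda>_. {..top}"])
    fix A :: "ennreal set" assume "A \<in> range atMost"
    then obtain y where A: "A = {..y}" by auto
    show "emeasure \<mu> A = emeasure \<nu> A"
      unfolding A by (cases y) (use eq top in auto)
  next
    show "Int_stable (range (atMost :: ennreal \<Rightarrow> _))"
      by (auto simp: Int_stable_def)
    show "(\<Union>i :: nat. {..top :: ennreal}) = UNIV"
      by (simp add: UNIV_top)
  qed (simp_all add: generated top)
qed

text \<open>For each horizon the event of a hit by time \<open>a\<close> is, on both sides, the
  preimage of one Borel set of sequences under sampling at one sequence of times in
  \<open>{0..a}\<close>. Equality of the sampled laws therefore gives equal distribution
  functions.\<close>

lemma hitting_time_distr_eq:
  assumes "prob_space M" "prob_space N"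
    and X: "\<And>t. 0 \<le> t \<Longrightarrow> X t \<in> borel_measurable M"
    and X_cont: "\<And>\<omega>. \<omega> \<in> space M \<Longrightarrow> continuous_on {0..} (\<lambda>t. X t \<omega>)"
    and Y: "\<And>t. 0 \<le> t \<Longrightarrow> Y t \<in> borel_measurable N"
    and Y_cont: "\<And>\<omega>. \<omega> \<in> space N \<Longrightarrow> continuous_on {0..} (\<lambda>t. Y t \<omega>)"
    and c: "continuous_on {0..} c"
    and eq: "\<And>a r. range r \<subseteq> {0..a} \<Longrightarrow>
      distr M borel (\<lambda>\<omega> (i :: nat). X (r i) \<omega>) = distr N borel (\<lambda>\<omega> i. Y (r i) \<omega>)"
  shows "distr M borel (hitting_time X c) = distr N borel (hitting_time Y c)"
proof -
  interpret M: prob_space M by fact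
  interpret N: prob_space N by fact
  have meas: "hitting_time X c \<in> borel_measurable M" "hitting_time Y c \<in> borel_measurable N"
    by (intro hitting_time_measurable X Y X_cont Y_cont c; assumption)+
  show ?thesis
  proof (intro borel_ennreal_eqI M.prob_space_distr N.prob_space_distr meas)
    fix a :: real assume a: "0 \<le> a"
    obtain r :: "nat \<Rightarrow> real" and E where r: "range r \<subseteq> {0..a}" and E: "E \<in> sets borel"
      and iff: "\<And>f. continuous_on {0..} f \<Longrightarrow> (\<exists>t\<in>{0..a}. f t = c t) \<longleftrightarrow> (\<lambda>i. f (r i)) \<in> E"
      by (rule path_hits_event[OF c a]) (rule that)
    have r_nonneg: "0 \<le> r i" for i using r by (auto simp: subset_iff)
    have mX: "(\<lambda>\<omega> i. X (r i) \<omega>) \<in> borel_measurable M"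
      by (intro measurable_coordinatewise_then_product X r_nonneg)
    have mY: "(\<lambda>\<omega> i. Y (r i) \<omega>) \<in> borel_measurable N"
      by (intro measurable_coordinatewise_then_product Y r_nonneg)
    have "emeasure (distr M borel (hitting_time X c)) {..ennreal a} =
        emeasure M {\<omega> \<in> space M. (\<lambda>i. X (r i) \<omega>) \<in> E}"
      using hitting_time_le_iff[of X _ c a, OF X_cont c a] iff[OF X_cont]
      by (subst emeasure_distr[OF meas(1)]) (auto intro!: arg_cong[of _ _ "emeasure M"])
    also have "\<dots> = emeasure (distr M borel (\<lambda>\<omega> i. X (r i) \<omega>)) E"
      by (subst emeasure_distr[OF mX E]) (auto intro!: arg_cong[of _ _ "emeasure M"])
    also have "\<dots> = emeasure (distr N borel (\<lambda>\<omega> i. Y (r i) \<omega>)) E"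
      by (simp only: eq[OF r])
    also have "\<dots> = emeasure N {\<omega> \<in> space N. (\<lambda>i. Y (r i) \<omega>) \<in> E}"
      by (subst emeasure_distr[OF mY E]) (auto intro!: arg_cong[of _ _ "emeasure N"])
    also have "\<dots> = emeasure (distr N borel (hitting_time Y c)) {..ennreal a}"
      using hitting_time_le_iff[of Y _ c a, OF Y_cont c a] iff[OF Y_cont]
      by (subst emeasure_distr[OF meas(2)]) (auto intro!: arg_cong[of _ _ "emeasure N"])
    finally show "emeasure (distr M borel (hitting_time X c)) {..ennreal a} =
        emeasure (distr N borel (hitting_time Y c)) {..ennreal a}" .
  qed simp_all
qed

section \<open>The integrating factor and the deterministic time change\<close>

text \<open>The exponential of the integral of \<open>d0 / (1 + b * d0 * s)\<close> over
  \<open>{0..t}\<close>, that is, the integrating factor of the drift; the case \<open>b = 0\<close>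
  is its limit.\<close>

definition growth :: "real \<Rightarrow> real \<Rightarrow> real \<Rightarrow> real" where
  "growth d0 b t = (if b = 0 then exp (d0 * t) else (1 + b * d0 * t) powr (1 / b))"

lemma q_path_eq_growth: "q_path q0 d0 b t = q0 / growth d0 b t"
  using powr_minus[of "1 + b * d0 * t" "1 / b"]
  by (simp add: q_path_def growth_def exp_minus divide_inverse)

lemma growth_0 [simp]: "growth d0 b 0 = 1"
  by (simp add: growth_def)

lemma tau_0 [simp]: "tau d0 b 0 = 0"
  by (simp add: tau_def)

context
  fixes d0 b :: real
  assumes d0: "0 < d0" and b: "0 \<le> b"
begin

lemma base_ge_1: "0 \<le> t \<Longrightarrow> 1 \<le> 1 + b * d0 * t"
  using d0 b by simp

lemma growth_ge_1: "0 \<le> t \<Longrightarrow> 1 \<le> growth d0 b t"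
  using d0 b base_ge_1[of t] by (auto simp: growth_def ge_one_powr_ge_zero)

lemma growth_has_derivative:
  assumes "0 \<le> t"
  shows "(growth d0 b has_real_derivative d0 / (1 + b * d0 * t) * growth d0 b t) (at t within T)"
proof (cases "b = 0")
  case True
  then show ?thesis
    unfolding growth_def[abs_def] by (auto intro!: derivative_eq_intros)
next
  case False
  have pos: "1 + b * d0 * t > 0" using base_ge_1[OF assms] by simp
  have "((\<lambda>t. (1 + b * d0 * t) powr (1 / b)) has_real_derivative
      1 / b * (1 + b * d0 * t) powr (1 / b - 1) * (b * d0)) (at t within T)"
    using pos by (auto intro!: derivative_eq_intros)
  moreover have "(1 + b * d0 * t) powr (1 / b - 1) = (1 + b * d0 * t) powr (1 / b) / (1 + b * d0 * t)"
    using pos by (simp add: powr_diff)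
  ultimately show ?thesis
    using False unfolding growth_def[abs_def] by (simp add: mult.commute)
qed

lemma growth_continuous: "continuous_on {0..} (growth d0 b)"
  using growth_has_derivative by (auto intro!: DERIV_continuous_on)

lemma tau_has_derivative:
  assumes "0 \<le> t"
  shows "(tau d0 b has_real_derivative (growth d0 b t)\<^sup>2) (at t within T)"
proof (cases "b = 0")
  case True
  then show ?thesis
    using d0 unfolding growth_def tau_def[abs_def]
    by (auto intro!: derivative_eq_intros simp: exp_double[symmetric] mult.assoc)
next
  case False
  have b2: "b + 2 \<noteq> 0" using b by simp
  have pos: "1 + b * d0 * t > 0" using base_ge_1[OF assms] by simp
  have "((\<lambda>t. 1 / (d0 * (b + 2)) * ((1 + b * d0 * t) powr (2 / b + 1) - 1)) has_real_derivative
      1 / (d0 * (b + 2)) * ((2 / b + 1) * (1 + b * d0 * t) powr (2 / b) * (b * d0))) (at t within T)"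
    using pos b2 by (auto intro!: derivative_eq_intros)
  \<comment> \<open>Since \<open>(2 / b + 1) * b = b + 2\<close>, the normalising constant of
    \<open>tau\<close> cancels exactly.\<close>
  moreover have "1 / (d0 * (b + 2)) * ((2 / b + 1) * (1 + b * d0 * t) powr (2 / b) * (b * d0)) =
      (1 + b * d0 * t) powr (2 / b)"
    using d0 b2 False by (simp add: divide_simps)
  moreover have "(1 + b * d0 * t) powr (2 / b) = (growth d0 b t)\<^sup>2"
    using False by (simp add: growth_def power2_eq_square flip: powr_add)
  ultimately show ?thesis
    using False unfolding tau_def[abs_def] by simp
qed

lemma tau_continuous: "continuous_on {0..} (tau d0 b)"
  using tau_has_derivative by (auto intro!: DERIV_continuous_on)

text \<open>The derivative of \<open>tau\<close> is the square of a function that is at least 1.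
  This one estimate yields strict monotonicity, nonnegativity and unboundedness of
  \<open>tau\<close>, hence its bijectivity on the half-line.\<close>

lemma tau_expanding:
  assumes "0 \<le> u" "u < v"
  shows "v - u \<le> tau d0 b v - tau d0 b u"
proof -
  obtain w where w: "u < w" "tau d0 b v - tau d0 b u = (v - u) * (growth d0 b w)\<^sup>2"
    by (rule mean_value_within[of u v "tau d0 b" "\<lambda>s. (growth d0 b s)\<^sup>2" UNIV])
      (use assms tau_has_derivative in auto)
  have "1 \<le> (growth d0 b w)\<^sup>2"
    using growth_ge_1[of w] w(1) assms(1) by (simp add: one_le_power)
  then show ?thesis
    unfolding w(2) using assms(2) mult_left_mono[of 1 "(growth d0 b w)\<^sup>2" "v - u"] by simp
qed

lemma tau_nonneg: "0 \<le> t \<Longrightarrow> 0 \<le> tau d0 b t"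
  using tau_expanding[of 0 t] by (cases "t = 0") auto

lemma tau_le_iff:
  assumes "0 \<le> u" "0 \<le> v"
  shows "tau d0 b u \<le> tau d0 b v \<longleftrightarrow> u \<le> v"
  using tau_expanding[of u v] tau_expanding[of v u] assms by (cases u v rule: linorder_cases) auto

lemma tau_inv_tau: "0 \<le> t \<Longrightarrow> tau_inv d0 b (tau d0 b t) = t"
  unfolding tau_inv_def
  by (rule the_inv_into_f_f) (auto intro!: inj_onI simp: tau_le_iff order.eq_iff)

lemma tau_surj:
  assumes "0 \<le> s"
  obtains t where "0 \<le> t" "tau d0 b t = s"
proof -
  \<comment> \<open>Expansion from 0 makes \<open>s\<close> itself an upper bound for the preimage,
    so the intermediate value theorem applies on \<open>{0..s}\<close>.\<close>
  have "s \<le> tau d0 b s"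
    using tau_expanding[of 0 s] assms by (cases "s = 0") auto
  moreover have "continuous_on {0..s} (tau d0 b)"
    by (rule continuous_on_subset[OF tau_continuous]) auto
  ultimately show thesis
    using IVT'[of "tau d0 b" 0 s s] assms that by auto
qed

text \<open>In the original clock the boundary is the image of the level \<open>x\<close> under the
  affine map that takes \<open>Q\<close> to the transformed process. For \<open>\<sigma> = 0\<close>
  both sides are 0 by the convention for division.\<close>

lemma c1_tau:
  assumes "0 \<le> t" "q0 \<noteq> 0"
  shows "c1 q0 d0 \<sigma> b x (tau d0 b t) = (x * growth d0 b t - q0) / \<sigma>"
  using assms by (cases "\<sigma> = 0") (auto simp: c1_def tau_inv_tau q_path_eq_growth field_simps)

text \<open>An increasing bijection of the half-line matches the contact times of \<open>W\<close>
  with \<open>c\<close> and those of the time-changed pair in order, so first contacts correspond;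
  by surjectivity no contact of \<open>W\<close> is missed when the time-changed pair never
  meets.\<close>

lemma tau_inv_ext_hitting_time:
  assumes W: "continuous_on {0..} (\<lambda>t. W t \<omega>)" and c: "continuous_on {0..} (\<lambda>t. c (tau d0 b t))"
  shows "tau_inv_ext d0 b (hitting_time W c \<omega>) =
    hitting_time (\<lambda>t. W (tau d0 b t)) (\<lambda>t. c (tau d0 b t)) \<omega>"
proof -
  have "continuous_on {0..} (\<lambda>t. W (tau d0 b t) \<omega>)"
    by (rule continuous_on_compose2[OF W tau_continuous]) (auto simp: tau_nonneg)
  then show ?thesis
    using c
  proof (cases rule: hitting_time_cases)
    case (hit s)
    have "hitting_time W c \<omega> = ennreal (tau d0 b s)"
      unfolding hitting_time_def
    proof (intro antisym INF_lower INF_greatest)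
      fix t assume "t \<in> {t. 0 \<le> t \<and> W t \<omega> = c t}"
      then obtain t' where "0 \<le> t'" "tau d0 b t' = t" "W t \<omega> = c t"
        using tau_surj[of t] by blast
      with hit show "ennreal (tau d0 b s) \<le> ennreal t"
        by (auto intro!: ennreal_leI simp: tau_le_iff)
    qed (use hit tau_nonneg in auto)
    with hit show ?thesis
      by (simp add: tau_inv_ext_def tau_nonneg tau_inv_tau)
  next
    case never
    have "{t. 0 \<le> t \<and> W t \<omega> = c t} = {}"
      using never(1) tau_surj by blast
    with never show ?thesis
      by (simp add: hitting_time_def tau_inv_ext_def)
  qed
qed

end

section \<open>Comparison of the transformed solution with the time-changed Brownian motion\<close>

lemma tendsto_coordinatewise:
  fixes f :: "'c \<Rightarrow> 'i \<Rightarrow> 'd :: topological_space"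
  assumes "\<And>i. ((\<lambda>n. f n i) \<longlongrightarrow> l i) F"
  shows "(f \<longlongrightarrow> l) F"
proof -
  have "limitin (product_topology (\<lambda>i. euclidean) UNIV) f l F"
    using assms by (simp add: limitin_componentwise)
  then show ?thesis by (simp add: euclidean_product_topology)
qed

lemma transformed_solution_distr_eq:
  assumes q0: "q0 > 0" and d0: "d0 > 0" and \<sigma>: "\<sigma> > 0" and b: "0 \<le> b"
    and B: "standard_brownian_motion M B"
    and Q: "additive_noise_sde_solution M B (\<lambda>t y. - (d0 * y / (1 + b * d0 * t))) \<sigma> q0 Q"
    and W: "standard_brownian_motion N W" and r: "range r \<subseteq> {0..a}"
  shows "distr M borel (\<lambda>\<omega> (i :: nat). (growth d0 b (r i) * Q (r i) \<omega> - q0) / \<sigma>) =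
    distr N borel (\<lambda>\<omega> i. W (tau d0 b (r i)) \<omega>)"
proof -
  interpret B: standard_brownian_motion M B by fact
  interpret W: standard_brownian_motion N W by fact
  let ?g = "growth d0 b"
  have r': "0 \<le> r i" "r i \<le> a" for i
    using r by (auto simp: subset_iff)
  \<comment> \<open>The mesh is \<open>1 / Suc n\<close> because the grid must be strictly
    increasing for every \<open>n\<close>, including 0; \<open>LIMSEQ_Suc\<close> later shifts the
    limits accordingly.\<close>
  define k where "k n i = nat \<lfloor>real (Suc n) * r i\<rfloor>" for n i
  define u where "u n j = real j / real (Suc n)" for n j
  define s where "s n l = (\<Sum>j<l. (?g (u n j))\<^sup>2 * (u n (Suc j) - u n j))" for n l
  have u: "0 \<le> u n j" "u n j < u n (Suc j)" for n j
    by (auto simp: u_def divide_strict_right_mono)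
  have s: "0 \<le> s n l" for n l
    unfolding s_def using u(2) by (intro sum_nonneg mult_nonneg_nonneg) (auto simp: less_imp_le)
  have [measurable]: "Q (r i) \<in> borel_measurable M" for i
    using Q r'(1) by (auto simp: additive_noise_sde_solution_def)
  note [measurable] = B.measurable_BM[OF u(1)] W.measurable_BM[OF s] W.measurable_BM[of 0]
    W.measurable_BM[OF tau_nonneg[OF d0 b r'(1)]]
  show ?thesis
  proof (rule distr_limit_eq[where
      X = "\<lambda>n \<omega> i. \<Sum>j<k n i. ?g (u n j) * (B (u n (Suc j)) \<omega> - B (u n j) \<omega>)" and
      Y = "\<lambda>n \<omega> i. W (s n (k n i)) \<omega> - W 0 \<omega>"])
    fix n
    show "distr M borel (\<lambda>\<omega> i. \<Sum>j<k n i. ?g (u n j) * (B (u n (Suc j)) \<omega> - B (u n j) \<omega>)) =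
        distr N borel (\<lambda>\<omega> i. W (s n (k n i)) \<omega> - W 0 \<omega>)"
      unfolding s_def
    \<comment> \<open>All sample times are at most \<open>a\<close>, so the number of cells below
      \<open>a\<close> bounds every \<open>k n i\<close> at once.\<close>
    proof (rule brownian_step_sums_distr_eq[where u = "u n" and K = "nat \<lfloor>real (Suc n) * a\<rfloor>"])
      show "0 \<le> u n 0" "u n j < u n (Suc j)" for j
        by (fact u)+
      show "?g (u n j) \<noteq> 0" for j
        using growth_ge_1[OF d0 b u(1)[of n j]] by simp
      show "k n i \<le> nat \<lfloor>real (Suc n) * a\<rfloor>" for i
        unfolding k_def by (intro nat_mono floor_mono mult_left_mono r') simp
    qed (fact B W)+
  next
    show "AE \<omega> in M. (\<lambda>n i. \<Sum>j<k n i. ?g (u n j) * (B (u n (Suc j)) \<omega> - B (u n j) \<omega>))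
        \<longlonglongrightarrow> (\<lambda>i. (?g (r i) * Q (r i) \<omega> - q0) / \<sigma>)"
    proof -
      let ?a = "\<lambda>t. d0 / (1 + b * d0 * t)"
      have sde: "AE \<omega> in M. \<forall>t\<ge>0. set_integrable lborel {0..t} (\<lambda>s. - (?a s * Q s \<omega>)) \<and>
          Q t \<omega> = q0 + (LBINT s:{0..t}. - (?a s * Q s \<omega>)) + \<sigma> * (B t \<omega> - B 0 \<omega>)"
        using Q by (simp add: additive_noise_sde_solution_def)
      have a_cont: "continuous_on {0..} ?a"
        using base_ge_1[OF d0 b] by (intro continuous_intros) fastforce
      from sde AE_space show ?thesis
      proof eventually_elim
        case (elim \<omega>)
        have Q_cont: "continuous_on {0..} (\<lambda>t. Q t \<omega>)"
          using Q elim(2) by (simp add: additive_noise_sde_solution_def)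
        have Q0: "Q 0 \<omega> = q0"
          using elim(1)[rule_format, of 0]
            set_borel_integral_eq_integral(2)[of "{0..0}" "\<lambda>s. - (?a s * Q s \<omega>)"] by simp
        show ?case
        proof (rule tendsto_coordinatewise)
          fix i
          have "(\<lambda>n. \<Sum>j<k n i. \<sigma> * (?g (u n j) * (B (u n (Suc j)) \<omega> - B (u n j) \<omega>)))
              \<longlonglongrightarrow> ?g (r i) * Q (r i) \<omega> - ?g 0 * Q 0 \<omega>"
            unfolding k_def u_def
            by (rule LIMSEQ_Suc[OF variation_of_constants_limit[OF
                  growth_has_derivative[OF d0 b] a_cont Q_cont elim(1)[rule_format] r'(1)]])
          then have "(\<lambda>n. (\<Sum>j<k n i. \<sigma> * (?g (u n j) * (B (u n (Suc j)) \<omega> - B (u n j) \<omega>))) / \<sigma>)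
              \<longlonglongrightarrow> (?g (r i) * Q (r i) \<omega> - q0) / \<sigma>"
            unfolding Q0 using \<sigma> by (intro tendsto_divide tendsto_const) auto
          then show "(\<lambda>n. \<Sum>j<k n i. ?g (u n j) * (B (u n (Suc j)) \<omega> - B (u n j) \<omega>))
              \<longlonglongrightarrow> (?g (r i) * Q (r i) \<omega> - q0) / \<sigma>"
            using \<sigma> by (simp flip: sum_distrib_left)
        qed
      qed
    qed
  next
    from W.start_at_zero AE_space
    show "AE \<omega> in N. (\<lambda>n i. W (s n (k n i)) \<omega> - W 0 \<omega>) \<longlonglongrightarrow> (\<lambda>i. W (tau d0 b (r i)) \<omega>)"
    \<comment> \<open>The sampling times on this side are deterministic Riemann sums converging to
      \<open>tau d0 b (r i)\<close>, so path continuity suffices; the subtracted \<open>W 0\<close>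
      vanishes almost surely.\<close>
    proof eventually_elim
      case (elim \<omega>)
      show ?case
      proof (rule tendsto_coordinatewise)
        fix i
        have "(\<lambda>n. s n (k n i)) \<longlonglongrightarrow> tau d0 b (r i) - tau d0 b 0"
          unfolding s_def k_def u_def
          by (rule LIMSEQ_Suc[OF riemann_sum_limit[OF tau_has_derivative[OF d0 b] _ r'(1)]])
            (assumption, intro continuous_intros growth_continuous[OF d0 b])
        then have "(\<lambda>n. W (s n (k n i)) \<omega>) \<longlonglongrightarrow> W (tau d0 b (r i)) \<omega>"
          using continuous_on_tendsto_compose[OF W.continuous_paths[OF elim(2)],
              of "\<lambda>n. s n (k n i)" "tau d0 b (r i)" sequentially]
            s tau_nonneg[OF d0 b r'(1)] by simp
        then show "(\<lambda>n. W (s n (k n i)) \<omega> - W 0 \<omega>) \<longlonglongrightarrow> W (tau d0 b (r i)) \<omega>"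
          using elim(1) by simp
      qed
    qed
  next
    show "(\<lambda>\<omega> i. \<Sum>j<k n i. ?g (u n j) * (B (u n (Suc j)) \<omega> - B (u n j) \<omega>)) \<in> borel_measurable M" for n
      by (rule measurable_coordinatewise_then_product) measurable
    show "(\<lambda>\<omega> i. (?g (r i) * Q (r i) \<omega> - q0) / \<sigma>) \<in> borel_measurable M"
      by (rule measurable_coordinatewise_then_product) measurable
    show "(\<lambda>\<omega> i. W (s n (k n i)) \<omega> - W 0 \<omega>) \<in> borel_measurable N" for n
      by (rule measurable_coordinatewise_then_product) measurable
    show "(\<lambda>\<omega> i. W (tau d0 b (r i)) \<omega>) \<in> borel_measurable N"
      by (rule measurable_coordinatewise_then_product) measurable
  qed (fact B.prob_space_axioms W.prob_space_axioms)+
qed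

theorem proposition3:
  fixes M :: "'a measure" and N :: "'b measure"
    and B Q :: "real \<Rightarrow> 'a \<Rightarrow> real" and W :: "real \<Rightarrow> 'b \<Rightarrow> real"
    and q0 d0 \<sigma> b x :: real
  assumes "q0 > 0" and "d0 > 0" and "\<sigma> > 0" and "0 \<le> b" and "b \<le> 1" and "x < q0"
    and "standard_brownian_motion M B"
    and "additive_noise_sde_solution M B (\<lambda>t y. - (d0 * y / (1 + b * d0 * t))) \<sigma> q0 Q"
    and "standard_brownian_motion N W"
  shows "hitting_time Q (\<lambda>_. x) \<in> borel_measurable M \<and>
    (\<lambda>\<omega>. tau_inv_ext d0 b (hitting_time W (c1 q0 d0 \<sigma> b x) \<omega>)) \<in> borel_measurable N \<and>
    distr M borel (hitting_time Q (\<lambda>_. x)) =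
      distr N borel (\<lambda>\<omega>. tau_inv_ext d0 b (hitting_time W (c1 q0 d0 \<sigma> b x) \<omega>))"
proof -
  interpret B: standard_brownian_motion M B by fact
  interpret W: standard_brownian_motion N W by fact
  note d0 = \<open>d0 > 0\<close> and b = \<open>0 \<le> b\<close>
  let ?g = "growth d0 b"
  define Z where "Z t \<omega> = (?g t * Q t \<omega> - q0) / \<sigma>" for t \<omega>
  define c where "c t = c1 q0 d0 \<sigma> b x (tau d0 b t)" for t
  define V where "V t = W (tau d0 b t)" for t
  have c_eq: "c t = (x * ?g t - q0) / \<sigma>" if "0 \<le> t" for t
    using c1_tau[OF d0 b that] \<open>q0 > 0\<close> by (simp add: c_def)
  have g_cont: "continuous_on {0..} ?g"
    by (rule growth_continuous[OF d0 b])
  have "continuous_on {0..} (\<lambda>t. (x * ?g t - q0) / \<sigma>)"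
    using \<open>\<sigma> > 0\<close> by (intro continuous_intros g_cont) auto
  then have c_cont: "continuous_on {0..} c"
    using c_eq by (subst continuous_on_cong[OF refl]) auto
  have Q: "Q t \<in> borel_measurable M" if "0 \<le> t" for t
    using assms(8) that by (simp add: additive_noise_sde_solution_def)
  have Q_cont: "continuous_on {0..} (\<lambda>t. Q t \<omega>)" if "\<omega> \<in> space M" for \<omega>
    using assms(8) that by (simp add: additive_noise_sde_solution_def)
  have Z: "Z t \<in> borel_measurable M" if "0 \<le> t" for t
    using Q[OF that] unfolding Z_def[abs_def] by measurable
  have Z_cont: "continuous_on {0..} (\<lambda>t. Z t \<omega>)" if "\<omega> \<in> space M" for \<omega>
    unfolding Z_def using \<open>\<sigma> > 0\<close> by (intro continuous_intros g_cont Q_cont that) auto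
  have V: "V t \<in> borel_measurable N" if "0 \<le> t" for t
    unfolding V_def by (intro W.measurable_BM tau_nonneg[OF d0 b that])
  have V_cont: "continuous_on {0..} (\<lambda>t. V t \<omega>)" if "\<omega> \<in> space N" for \<omega>
    unfolding V_def
    by (rule continuous_on_compose2[OF W.continuous_paths[OF that] tau_continuous[OF d0 b]])
      (auto simp: tau_nonneg[OF d0 b])
  \<comment> \<open>At each time the map from \<open>Q\<close> to \<open>Z\<close> is affine with
    positive slope, hence injective, and takes \<open>x\<close> to \<open>c t\<close>; the two
    contact sets are equal, not merely equal in law.\<close>
  have "Z t \<omega> = c t \<longleftrightarrow> Q t \<omega> = x" if "0 \<le> t" for t \<omega>
    using growth_ge_1[OF d0 b that] \<open>\<sigma> > 0\<close> that by (auto simp: Z_def c_eq)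
  then have hit_Q: "hitting_time Q (\<lambda>_. x) = hitting_time Z c"
    by (auto simp: hitting_time_def fun_eq_iff intro!: INF_cong)
  \<comment> \<open>Path continuity is known on \<open>space N\<close> only, so the identity is
    restricted to it; this is enough for both the law and measurability.\<close>
  have hit_W: "tau_inv_ext d0 b (hitting_time W (c1 q0 d0 \<sigma> b x) \<omega>) = hitting_time V c \<omega>"
    if "\<omega> \<in> space N" for \<omega>
    using tau_inv_ext_hitting_time[OF d0 b, where W = W and c = "c1 q0 d0 \<sigma> b x"] W.continuous_paths[OF that] c_cont
    by (simp add: V_def[abs_def] c_def[abs_def])
  have "distr M borel (hitting_time Z c) = distr N borel (hitting_time V c)"
  proof (rule hitting_time_distr_eq)
    show "distr M borel (\<lambda>\<omega> (i :: nat). Z (r i) \<omega>) = distr N borel (\<lambda>\<omega> i. V (r i) \<omega>)"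
      if "range r \<subseteq> {0..a}" for r a
      unfolding Z_def V_def by (rule transformed_solution_distr_eq[OF assms(1-4,7-9) that])
  qed (fact B.prob_space_axioms W.prob_space_axioms Z Z_cont V V_cont c_cont)+
  also have "\<dots> = distr N borel (\<lambda>\<omega>. tau_inv_ext d0 b (hitting_time W (c1 q0 d0 \<sigma> b x) \<omega>))"
    by (intro distr_cong refl) (simp add: hit_W)
  finally have "distr M borel (hitting_time Q (\<lambda>_. x)) =
      distr N borel (\<lambda>\<omega>. tau_inv_ext d0 b (hitting_time W (c1 q0 d0 \<sigma> b x) \<omega>))"
    unfolding hit_Q .
  moreover have "hitting_time Q (\<lambda>_. x) \<in> borel_measurable M"
    by (intro hitting_time_measurable Q Q_cont continuous_on_const)
  moreover have "hitting_time V c \<in> borel_measurable N"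
    by (intro hitting_time_measurable V V_cont c_cont)
  then have "(\<lambda>\<omega>. tau_inv_ext d0 b (hitting_time W (c1 q0 d0 \<sigma> b x) \<omega>)) \<in> borel_measurable N"
    using hit_W by (simp cong: measurable_cong)
  ultimately show ?thesis by blast
qed

end
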